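(* Let $\mathbb{L}=(L,\vee,\wedge,{\sim},{^*},0,1)$ be a regular pseudocomplemented Kleene algebra, let $\mathcal{F}_p$ be its set of prime filters, and let $g(P)=\{x\in L\mid {\sim}x\notin P\}$ for $P\in\mathcal{F}_p$. Let $\mathcal{U}(\mathcal{F}_p)$ be the family of $\subseteq$-upward-closed subsets of $\mathcal{F}_p$ with ${\sim}A=\{P\mid g(P)\notin A\}$ and $A^*=\{P\mid {\uparrow}P\cap A=\emptyset\}$, where ${\uparrow}P=\{Q\in\mathcal{F}_p\mid P\subseteq Q\}$. The following are equivalent: (a) $\mathbb{L}$ satisfies $x^*\vee x^{**}=1$ for all $x\in L$; (b) $(\mathcal{F}_p,\subseteq)$ is a union of disjoint chains of at most two elements; (c) the algebra $(\mathcal{U}(\mathcal{F}_p),\cup,\cap,{\sim},{^*},\emptyset,\mathcal{F}_p)$ satisfies the Stone identity $A^*\cup A^{**}=\mathcal{F}_p$ for all $A\in\mathcal{U}(\mathcal{F}_p)$.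
   Context: A pseudocomplemented Kleene algebra is an algebra $(L,\vee,\wedge,{\sim},{^*},0,1)$ such that $(L,\vee,\wedge,0,1)$ is a bounded distributive lattice, ${\sim}{\sim}x=x$, $x\leq y\Rightarrow{\sim}x\geq{\sim}y$, $x\wedge{\sim}x\leq y\vee{\sim}y$, and ${^*}$ is the pseudocomplement ($x\wedge z=0$ iff $z\leq x^*$); it is regular if $x^*=y^*$ and $({\sim}x)^*=({\sim}y)^*$ imply $x=y$. A prime filter is a filter $P\neq L$ such that $a\vee b\in P$ implies $a\in P$ or $b\in P$. "Union of disjoint chains of at most two elements" means the set can be partitioned into chains of at most two elements such that elements of different blocks are incomparable. *)

theory Defs
  imports Main "HOL-Library.Disjoint_Sets"
begin

class pseudocomplemented_kleene_algebra = distrib_lattice + bounded_lattice +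
  fixes kneg :: "'a \<Rightarrow> 'a"
    and pcompl :: "'a \<Rightarrow> 'a"
  assumes kneg_kneg: "kneg (kneg x) = x"
    and kneg_antimono: "x \<le> y \<Longrightarrow> kneg y \<le> kneg x"
    and kleene: "inf x (kneg x) \<le> sup y (kneg y)"
    and pcompl_iff: "inf x z = bot \<longleftrightarrow> z \<le> pcompl x"

class regular_pseudocomplemented_kleene_algebra = pseudocomplemented_kleene_algebra +
  assumes regular:
    "pcompl x = pcompl y \<Longrightarrow> pcompl (kneg x) = pcompl (kneg y) \<Longrightarrow> x = y"

text \<open>Filters are nonempty. The trivial one-element algebra is allowed; it has no prime filter.\<close>

definition lattice_filter :: "'a::lattice set \<Rightarrow> bool" where
  "lattice_filter P \<longleftrightarrow> P \<noteq> {} \<and> (\<forall>x\<in>P. \<forall>y. x \<le> y \<longrightarrow> y \<in> P) \<and> (\<forall>x\<in>P. \<forall>y\<in>P. inf x y \<in> P)"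

definition prime_filters :: "'a::lattice set set" where
  "prime_filters =
    {P. lattice_filter P \<and> P \<noteq> UNIV \<and> (\<forall>a b. sup a b \<in> P \<longrightarrow> a \<in> P \<or> b \<in> P)}"

definition g :: "'a::pseudocomplemented_kleene_algebra set \<Rightarrow> 'a set" where
  "g P = {x. kneg x \<notin> P}"

definition up :: "'a::lattice set \<Rightarrow> 'a set set" where
  "up P = {Q \<in> prime_filters. P \<subseteq> Q}"

definition upsets :: "'a::lattice set set set" where
  "upsets = {A. A \<subseteq> prime_filters \<and> (\<forall>P\<in>A. \<forall>Q\<in>prime_filters. P \<subseteq> Q \<longrightarrow> Q \<in> A)}"

definition upset_neg :: "'a::pseudocomplemented_kleene_algebra set set \<Rightarrow> 'a set set" where
  "upset_neg A = {P \<in> prime_filters. g P \<notin> A}"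

definition upset_star :: "'a::lattice set set \<Rightarrow> 'a set set" where
  "upset_star A = {P \<in> prime_filters. up P \<inter> A = {}}"

text \<open>Algebras of the same signature whose universe is a set rather than a whole type; used for
  the algebra of up-sets. Operations matter only on the universe.\<close>

record 'b pk_structure =
  universe :: "'b set"
  join :: "'b \<Rightarrow> 'b \<Rightarrow> 'b"
  meet :: "'b \<Rightarrow> 'b \<Rightarrow> 'b"
  negation :: "'b \<Rightarrow> 'b"
  star :: "'b \<Rightarrow> 'b"
  least :: 'b
  greatest :: 'b

definition satisfies_stone :: "'b pk_structure \<Rightarrow> bool" where
  "satisfies_stone S \<longleftrightarrow>
    (\<forall>x \<in> universe S. join S (star S x) (star S (star S x)) = greatest S)"

definition upset_algebra :: "'a::pseudocomplemented_kleene_algebra set set pk_structure" where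
  "upset_algebra =
    \<lparr>universe = upsets, join = (\<union>), meet = (\<inter>), negation = upset_neg, star = upset_star,
     least = {}, greatest = prime_filters\<rparr>"

definition union_of_disjoint_chains_le_2 :: "'b::order set \<Rightarrow> bool" where
  "union_of_disjoint_chains_le_2 X \<longleftrightarrow>
    (\<exists>\<C>. partition_on X \<C> \<and>
      (\<forall>C\<in>\<C>. Complete_Partial_Order.chain (\<le>) C \<and> finite C \<and> card C \<le> 2) \<and>
      (\<forall>C\<in>\<C>. \<forall>D\<in>\<C>. C \<noteq> D \<longrightarrow> (\<forall>x\<in>C. \<forall>y\<in>D. \<not> x \<le> y \<and> \<not> y \<le> x)))"

end

theory Submission
  imports Defs
begin

text \<open>Regularity yields \<open>b \<sqinter> b\<^sup>+ \<le> y \<squnion> y\<^sup>*\<close> for the dual pseudocomplement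
  \<open>b\<^sup>+ = \<sim>(\<sim>b)\<^sup>*\<close>. A prime filter \<open>Q\<close> lying strictly above another one contains some
  \<open>b \<sqinter> b\<^sup>+\<close>, hence all \<open>y \<squnion> y\<^sup>*\<close>, which makes it maximal; so there are no chains of three
  prime filters. Then each of the three conditions is equivalent to the following: prime filters with a
  common lower bound are comparable. The map \<^const>\<open>g\<close> dualizes this to prime filters with
  a common upper bound, so comparability is an equivalence relation and its classes are the
  required chains.\<close>

section \<open>Posets that split into chains of at most two elements\<close>

definition up_linear :: "'b::order set \<Rightarrow> bool" where
  "up_linear X \<longleftrightarrow> (\<forall>x\<in>X. \<forall>y\<in>X. \<forall>z\<in>X. x \<le> y \<longrightarrow> x \<le> z \<longrightarrow> y \<le> z \<or> z \<le> y)"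

lemma up_linearD:
  "up_linear X \<Longrightarrow> x \<in> X \<Longrightarrow> y \<in> X \<Longrightarrow> z \<in> X \<Longrightarrow> x \<le> y \<Longrightarrow> x \<le> z \<Longrightarrow> y \<le> z \<or> z \<le> y"
  unfolding up_linear_def by blast

lemma finite_card_le_2I:
  assumes "\<And>x y z. x \<in> C \<Longrightarrow> y \<in> C \<Longrightarrow> z \<in> C \<Longrightarrow> x = y \<or> y = z \<or> x = z"
  shows "finite C \<and> card C \<le> 2"
proof (cases "\<exists>x\<in>C. \<exists>y\<in>C. x \<noteq> y")
  case True
  then obtain x y where "x \<in> C" "y \<in> C" "x \<noteq> y" by blast
  with assms have "C = {x, y}" by blast
  then show ?thesis by (simp add: card_insert_if)
next
  case False
  show ?thesis
  proof (cases "C = {}")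
    case False
    then obtain x where "x \<in> C" by blast
    with \<open>\<not> (\<exists>x\<in>C. \<exists>y\<in>C. x \<noteq> y)\<close> have "C = {x}" by blast
    then show ?thesis by simp
  qed simp
qed

text \<open>Comparable elements share a block, so everything above \<open>x\<close> lies in the
  block of \<open>x\<close>, which is a chain.\<close>

lemma up_linear_if_union_of_disjoint_chains:
  assumes "union_of_disjoint_chains_le_2 X"
  shows "up_linear X"
  unfolding up_linear_def
proof (intro ballI impI)
  fix x y z assume X: "x \<in> X" "y \<in> X" "z \<in> X" and le: "x \<le> y" "x \<le> z"
  obtain \<C> where part: "partition_on X \<C>"
    and chain: "\<And>C. C \<in> \<C> \<Longrightarrow> Complete_Partial_Order.chain (\<le>) C"
    and incomp: "\<And>C D u v. C \<in> \<C> \<Longrightarrow> D \<in> \<C> \<Longrightarrow> C \<noteq> D \<Longrightarrow> u \<in> C \<Longrightarrow> v \<in> D \<Longrightarrow> \<not> u \<le> v"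
    using assms unfolding union_of_disjoint_chains_le_2_def by metis
  have cover: "\<exists>C\<in>\<C>. u \<in> C" if "u \<in> X" for u
    using partition_onD1[OF part] that by blast
  obtain C where C: "C \<in> \<C>" "x \<in> C" using cover X by blast
  have "y \<in> C" "z \<in> C" using cover X C incomp le by metis+
  then show "y \<le> z \<or> z \<le> y" using chain[OF C(1)] unfolding chain_def by blast
qed

lemma union_of_disjoint_chains_le_2I:
  assumes up: "up_linear X"
    and down: "\<And>x y z. x \<in> X \<Longrightarrow> y \<in> X \<Longrightarrow> z \<in> X \<Longrightarrow> x \<le> z \<Longrightarrow> y \<le> z \<Longrightarrow> x \<le> y \<or> y \<le> x"
    and short: "\<And>x y z. x \<in> X \<Longrightarrow> y \<in> X \<Longrightarrow> z \<in> X \<Longrightarrow> x < y \<Longrightarrow> y < z \<Longrightarrow> False"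
  shows "union_of_disjoint_chains_le_2 X"
proof -
  define r where "r = {(x, y). x \<in> X \<and> y \<in> X \<and> (x \<le> y \<or> y \<le> x)}"
  have "trans r"
  proof (rule transI)
    fix x y z assume "(x, y) \<in> r" "(y, z) \<in> r"
    then show "(x, z) \<in> r"
      \<comment> \<open>If \<open>y\<close> is above both elements, \<open>down\<close> applies; if
        it is below both, \<open>up\<close> applies; if it lies between them, the order is
        transitive.\<close>
      using down[of x z y] up_linearD[OF up, of y x z] order_trans[of x y z] order_trans[of z y x]
      unfolding r_def by blast
  qed
  then have eq: "equiv X r"
    by (intro equivI refl_onI symI) (auto simp: r_def)
  have chain: "Complete_Partial_Order.chain (\<le>) C" if "C \<in> X // r" for C
    unfolding chain_def using quotient_eq_iff[OF eq that that] in_quotient_imp_in_rel[OF eq that]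
    by (auto simp: r_def)
  have small: "finite C \<and> card C \<le> 2" if C: "C \<in> X // r" for C
  proof (rule finite_card_le_2I)
    fix x y z assume xyz: "x \<in> C" "y \<in> C" "z \<in> C"
    have X: "x \<in> X" "y \<in> X" "z \<in> X" using xyz in_quotient_imp_subset[OF eq C] by auto
    have "x \<le> y \<or> y \<le> x" "y \<le> z \<or> z \<le> y" "x \<le> z \<or> z \<le> x"
      using chain[OF C] xyz unfolding chain_def by auto
    \<comment> \<open>Three distinct, pairwise comparable elements would form a strict chain in some
      order, against \<open>short\<close>.\<close>
    then show "x = y \<or> y = z \<or> x = z"
      using short X by (metis order_le_imp_less_or_eq)
  qed
  have incomp: "\<not> x \<le> y \<and> \<not> y \<le> x"
    if "C \<in> X // r" "D \<in> X // r" "C \<noteq> D" "x \<in> C" "y \<in> D" for C D x y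
  proof -
    have "(x, y) \<notin> r" using quotient_eqI[OF eq that(1,2,4,5)] that(3) by blast
    moreover have "x \<in> X" "y \<in> X"
      using that in_quotient_imp_subset[OF eq] by blast+
    ultimately show ?thesis by (auto simp: r_def)
  qed
  show ?thesis
    unfolding union_of_disjoint_chains_le_2_def
    using partition_on_quotient[OF eq] chain small incomp by (intro exI[of _ "X // r"]) blast
qed

section \<open>Prime filters\<close>

lemma prime_filter_up: "P \<in> prime_filters \<Longrightarrow> x \<in> P \<Longrightarrow> x \<le> y \<Longrightarrow> y \<in> P"
  unfolding prime_filters_def lattice_filter_def by blast

lemma prime_filter_inf: "P \<in> prime_filters \<Longrightarrow> x \<in> P \<Longrightarrow> y \<in> P \<Longrightarrow> inf x y \<in> P"
  unfolding prime_filters_def lattice_filter_def by blast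

lemma prime_filter_sup: "P \<in> prime_filters \<Longrightarrow> sup a b \<in> P \<Longrightarrow> a \<in> P \<or> b \<in> P"
  unfolding prime_filters_def by blast

lemma prime_filter_top: "P \<in> prime_filters \<Longrightarrow> (top::'a::bounded_lattice) \<in> P"
  unfolding prime_filters_def lattice_filter_def using top_greatest by blast

lemma prime_filter_bot: "P \<in> prime_filters \<Longrightarrow> (bot::'a::bounded_lattice) \<notin> P"
  unfolding prime_filters_def lattice_filter_def using bot_least by blast

text \<open>For a filter \<open>F\<close> this is the filter generated by \<open>F\<close> and
  \<open>b\<close>.\<close>

definition adjoin :: "'a::lattice set \<Rightarrow> 'a \<Rightarrow> 'a set" where
  "adjoin F b = {y. \<exists>m\<in>F. inf m b \<le> y}"

lemma subset_adjoin: "F \<subseteq> adjoin F b"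
  unfolding adjoin_def using inf.cobounded1 by blast

lemma in_adjoin: "lattice_filter F \<Longrightarrow> b \<in> adjoin F b"
  unfolding adjoin_def lattice_filter_def using inf.cobounded2 by blast

lemma adjoin_filter:
  assumes "lattice_filter F"
  shows "lattice_filter (adjoin F b)"
  unfolding lattice_filter_def
proof (intro conjI ballI allI impI)
  show "adjoin F b \<noteq> {}"
    using assms in_adjoin by blast
  fix x assume x: "x \<in> adjoin F b"
  show "y \<in> adjoin F b" if "x \<le> y" for y
    using x that unfolding adjoin_def by (blast intro: order_trans)
  fix y assume "y \<in> adjoin F b"
  with x obtain m n where "m \<in> F" "inf m b \<le> x" "n \<in> F" "inf n b \<le> y"
    unfolding adjoin_def by blast
  moreover from this have "inf (inf m n) b \<le> inf x y"
    by (meson inf.boundedI inf.cobounded1 inf.cobounded2 inf_mono order_refl order_trans)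
  moreover have "inf m n \<in> F"
    using assms calculation unfolding lattice_filter_def by blast
  ultimately show "inf x y \<in> adjoin F b" unfolding adjoin_def by blast
qed

text \<open>Zorn's lemma gives a filter \<open>M\<close> maximal among those that contain
  \<open>F\<close> and miss \<open>a\<close>. Adjoining any element outside \<open>M\<close> reaches
  \<open>a\<close>, and distributivity turns this into primeness.\<close>

lemma prime_filter_separation:
  fixes a :: "'a::distrib_lattice"
  assumes F: "lattice_filter F" and a: "a \<notin> F"
  obtains P where "P \<in> prime_filters" "F \<subseteq> P" "a \<notin> P"
proof -
  define \<A> where "\<A> = {G. lattice_filter G \<and> F \<subseteq> G \<and> a \<notin> G}"
  have "\<Union>\<C> \<in> \<A>" if "\<C> \<noteq> {}" and chain: "subset.chain \<A> \<C>" for \<C>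
  proof -
    have sub: "\<C> \<subseteq> \<A>" and lin: "\<And>G H. G \<in> \<C> \<Longrightarrow> H \<in> \<C> \<Longrightarrow> G \<subseteq> H \<or> H \<subseteq> G"
      using chain unfolding subset_chain_def by auto
    have "inf x y \<in> \<Union>\<C>" if "x \<in> \<Union>\<C>" "y \<in> \<Union>\<C>" for x y
    proof -
      obtain G where "G \<in> \<C>" "x \<in> G" "y \<in> G" using \<open>x \<in> \<Union>\<C>\<close> \<open>y \<in> \<Union>\<C>\<close> lin by blast
      then show ?thesis using sub unfolding \<A>_def lattice_filter_def by blast
    qed
    moreover have "y \<in> \<Union>\<C>" if "x \<in> \<Union>\<C>" "x \<le> y" for x y
      using that sub unfolding \<A>_def lattice_filter_def by blast
    moreover have "F \<subseteq> \<Union>\<C>" "a \<notin> \<Union>\<C>"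
      using \<open>\<C> \<noteq> {}\<close> sub unfolding \<A>_def by auto
    moreover have "F \<noteq> {}" using F unfolding lattice_filter_def by blast
    ultimately show ?thesis unfolding \<A>_def lattice_filter_def by blast
  qed
  moreover have "\<A> \<noteq> {}" using F a unfolding \<A>_def by blast
  ultimately obtain M where M: "M \<in> \<A>" and max: "\<And>G. G \<in> \<A> \<Longrightarrow> M \<subseteq> G \<Longrightarrow> G = M"
    using subset_Zorn_nonempty[of \<A>] by blast
  have filt: "lattice_filter M" and FM: "F \<subseteq> M" and aM: "a \<notin> M"
    using M unfolding \<A>_def by auto
  have below: "\<exists>m\<in>M. inf m b \<le> a" if "b \<notin> M" for b
  proof -
    have "adjoin M b \<noteq> M" using in_adjoin[OF filt] that by blast
    then have "adjoin M b \<notin> \<A>" using max subset_adjoin by blast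
    then have "a \<in> adjoin M b"
      using adjoin_filter[OF filt] subset_adjoin FM unfolding \<A>_def by blast
    then show ?thesis unfolding adjoin_def by blast
  qed
  have "b \<in> M \<or> c \<in> M" if bc: "sup b c \<in> M" for b c
  proof (rule ccontr)
    assume "\<not> (b \<in> M \<or> c \<in> M)"
    then obtain m n where mn: "m \<in> M" "n \<in> M" and "inf m b \<le> a" "inf n c \<le> a"
      using below by blast
    \<comment> \<open>Distributivity splits the left side into a part below \<open>inf m b\<close>
      and a part below \<open>inf n c\<close>, so \<open>sup b c\<close> in \<open>M\<close> would
      force \<open>a\<close> into \<open>M\<close>.\<close>
    then have "inf (inf m n) (sup b c) \<le> a"
      unfolding inf_sup_distrib1
      by (meson inf.cobounded1 inf.cobounded2 inf_mono le_supI order_refl order_trans)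
    moreover have "inf (inf m n) (sup b c) \<in> M"
      using mn bc filt unfolding lattice_filter_def by blast
    ultimately show False using filt aM unfolding lattice_filter_def by blast
  qed
  then have "M \<in> prime_filters" using filt aM unfolding prime_filters_def by blast
  with FM aM that show thesis by blast
qed

section \<open>Pseudocomplemented Kleene algebras\<close>

lemma kneg_sup: "kneg (sup x y) = inf (kneg x) (kneg y)"
  for x :: "'a::pseudocomplemented_kleene_algebra"
proof (rule order.antisym)
  have "x \<le> kneg (inf (kneg x) (kneg y))" "y \<le> kneg (inf (kneg x) (kneg y))"
    by (metis inf.cobounded1 kneg_antimono kneg_kneg) (metis inf.cobounded2 kneg_antimono kneg_kneg)
  then show "inf (kneg x) (kneg y) \<le> kneg (sup x y)"
    by (metis kneg_antimono kneg_kneg le_supI)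
qed (simp add: kneg_antimono)

lemma kneg_inf: "kneg (inf x y) = sup (kneg x) (kneg y)"
  for x :: "'a::pseudocomplemented_kleene_algebra"
  by (metis kneg_kneg kneg_sup)

lemma kneg_bot: "kneg bot = (top::'a::pseudocomplemented_kleene_algebra)"
  by (metis bot_least kneg_antimono kneg_kneg top_unique)

lemma kneg_top: "kneg top = (bot::'a::pseudocomplemented_kleene_algebra)"
  by (metis kneg_bot kneg_kneg)

lemma inf_pcompl: "inf x (pcompl x) = (bot::'a::pseudocomplemented_kleene_algebra)"
  by (simp add: pcompl_iff)

text \<open>The pseudocomplement is the largest element disjoint from the given one, hence
  determined by the set of disjoint elements.\<close>

lemma pcompl_eqI:
  fixes x y :: "'a::pseudocomplemented_kleene_algebra"
  assumes "\<And>z. inf x z = bot \<longleftrightarrow> inf y z = bot"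
  shows "pcompl x = pcompl y"
proof (rule order.antisym)
  show "pcompl x \<le> pcompl y"
    using assms[of "pcompl x"] by (simp add: pcompl_iff)
  show "pcompl y \<le> pcompl x"
    using assms[of "pcompl y"] by (simp add: pcompl_iff)
qed

text \<open>An element disjoint from the join lies below \<open>pcompl x\<close> and is also
  disjoint from it.\<close>

lemma dense_sup_pcompl:
  fixes x :: "'a::pseudocomplemented_kleene_algebra"
  assumes "inf (sup x (pcompl x)) z = bot"
  shows "z = bot"
proof -
  have "inf x z = bot" "inf (pcompl x) z = bot"
    using assms by (simp_all add: inf_sup_distrib2)
  then have "z \<le> pcompl x" by (simp add: pcompl_iff)
  with \<open>inf (pcompl x) z = bot\<close> show ?thesis by (simp add: inf.absorb2)
qed

text \<open>With \<open>u\<close> and \<open>v\<close> the two sides of the inequality, \<open>u \<sqinter> v\<close> and \<open>u\<close> have the same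
  pseudocomplement as \<open>v\<close> is dense, and \<open>\<sim>(u \<sqinter> v)\<close> and \<open>\<sim>u\<close> do as both are dense.\<close>

lemma kneg_dense_le_dense:
  fixes w y :: "'a::regular_pseudocomplemented_kleene_algebra"
  shows "kneg (sup w (pcompl w)) \<le> sup y (pcompl y)"
proof -
  let ?u = "kneg (sup w (pcompl w))" and ?v = "sup y (pcompl y)"
  have "pcompl (inf ?u ?v) = pcompl ?u"
  proof (rule pcompl_eqI)
    fix z
    have "inf (inf ?u ?v) z = inf ?v (inf ?u z)" by (simp add: ac_simps)
    then show "inf (inf ?u ?v) z = bot \<longleftrightarrow> inf ?u z = bot"
      using dense_sup_pcompl by (metis inf_bot_right)
  qed
  moreover have "pcompl (kneg (inf ?u ?v)) = pcompl (kneg ?u)"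
  proof (rule pcompl_eqI)
    fix z
    have "inf (sup (sup w (pcompl w)) (kneg ?v)) z = bot \<longleftrightarrow> z = bot"
      using dense_sup_pcompl[of w z] by (auto simp: inf_sup_distrib2)
    moreover have "inf (sup w (pcompl w)) z = bot \<longleftrightarrow> z = bot"
      using dense_sup_pcompl[of w z] by auto
    ultimately show "inf (kneg (inf ?u ?v)) z = bot \<longleftrightarrow> inf (kneg ?u) z = bot"
      by (simp add: kneg_inf kneg_kneg)
  qed
  ultimately have "inf ?u ?v = ?u" by (rule regular)
  then show ?thesis by (simp add: inf.absorb_iff1)
qed

lemma dense_in_nonminimal_prime_filter:
  fixes y :: "'a::regular_pseudocomplemented_kleene_algebra"
  assumes P: "P \<in> prime_filters" and Q: "Q \<in> prime_filters" and "P \<subset> Q"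
  shows "y \<in> Q \<or> pcompl y \<in> Q"
proof -
  obtain b where b: "b \<in> Q" "b \<notin> P" using \<open>P \<subset> Q\<close> by blast
  \<comment> \<open>Dual of \<open>inf_pcompl\<close>: as \<open>P\<close> misses \<open>b\<close>,
    primeness puts the dual pseudocomplement of \<open>b\<close> into \<open>P\<close> and hence
    into \<open>Q\<close>.\<close>
  have "sup b (kneg (pcompl (kneg b))) = top"
    by (metis inf_pcompl kneg_bot kneg_inf kneg_kneg)
  then have "kneg (pcompl (kneg b)) \<in> Q"
    using prime_filter_sup[OF P] prime_filter_top[OF P] b \<open>P \<subset> Q\<close> by (metis psubset_imp_subset subsetD)
  \<comment> \<open>By De Morgan this is the meet of \<open>b\<close> with its dual
    pseudocomplement, written as the left side of \<open>kneg_dense_le_dense\<close> with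
    \<open>w = kneg b\<close>.\<close>
  then have "kneg (sup (kneg b) (pcompl (kneg b))) \<in> Q"
    using b prime_filter_inf[OF Q] by (simp add: kneg_sup kneg_kneg)
  then show ?thesis
    using kneg_dense_le_dense prime_filter_up[OF Q] prime_filter_sup[OF Q] by blast
qed

lemma pcompl_notin_prime_filter:
  fixes y :: "'a::pseudocomplemented_kleene_algebra"
  assumes "P \<in> prime_filters" "y \<in> P"
  shows "pcompl y \<notin> P"
  using prime_filter_inf[OF assms(1), of y "pcompl y"] prime_filter_bot[OF assms(1)] assms(2)
  by (auto simp: inf_pcompl)

text \<open>For \<open>a\<close> in \<open>R\<close> but not in \<open>Q\<close>, the nonminimal
  filter \<open>Q\<close> contains \<open>pcompl a\<close>; then \<open>R\<close> contains
  both.\<close>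

lemma no_three_chain_prime_filters:
  fixes P :: "'a::regular_pseudocomplemented_kleene_algebra set"
  assumes "P \<in> prime_filters" "Q \<in> prime_filters" "R \<in> prime_filters" "P \<subset> Q" "Q \<subset> R"
  shows False
proof -
  obtain a where "a \<in> R" "a \<notin> Q" using assms by blast
  then show False
    using dense_in_nonminimal_prime_filter[of P Q a] pcompl_notin_prime_filter[of R a] assms by blast
qed

text \<open>The involution \<open>kneg\<close> carries \<open>P\<close> to a prime ideal, and
  \<open>g P\<close> is its complement. Closure under meets thus comes from primeness of
  \<open>P\<close>, and primeness from closure under meets.\<close>

lemma g_prime_filter:
  fixes P :: "'a::pseudocomplemented_kleene_algebra set"
  assumes P: "P \<in> prime_filters"
  shows "g P \<in> prime_filters"
proof -
  have "top \<in> g P" "bot \<notin> g P"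
    using prime_filter_top[OF P] prime_filter_bot[OF P] by (auto simp: g_def kneg_top kneg_bot)
  moreover have "y \<in> g P" if "x \<in> g P" "x \<le> y" for x y
    using that prime_filter_up[OF P] kneg_antimono by (auto simp: g_def)
  moreover have "inf x y \<in> g P" if "x \<in> g P" "y \<in> g P" for x y
    using that prime_filter_sup[OF P] by (auto simp: g_def kneg_inf)
  moreover have "a \<in> g P \<or> b \<in> g P" if "sup a b \<in> g P" for a b
    using that prime_filter_inf[OF P] by (auto simp: g_def kneg_sup)
  ultimately show ?thesis
    unfolding prime_filters_def lattice_filter_def by blast
qed

lemma g_subset_iff: "g P \<subseteq> g Q \<longleftrightarrow> Q \<subseteq> P"
proof
  assume sub: "g P \<subseteq> g Q"
  show "Q \<subseteq> P"
  proof
    fix x assume "x \<in> Q"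
    then have "kneg x \<notin> g Q" by (simp add: g_def kneg_kneg)
    with sub have "kneg x \<notin> g P" by blast
    then show "x \<in> P" by (simp add: g_def kneg_kneg)
  qed
qed (auto simp: g_def)

lemma union_of_disjoint_chains_iff_up_linear:
  "union_of_disjoint_chains_le_2
     (prime_filters :: 'a::regular_pseudocomplemented_kleene_algebra set set) \<longleftrightarrow>
   up_linear (prime_filters :: 'a set set)"
proof
  assume up: "up_linear (prime_filters :: 'a set set)"
  show "union_of_disjoint_chains_le_2 (prime_filters :: 'a set set)"
  proof (rule union_of_disjoint_chains_le_2I[OF up])
    fix P Q R :: "'a set"
    assume "P \<in> prime_filters" "Q \<in> prime_filters" "R \<in> prime_filters" "P \<subseteq> R" "Q \<subseteq> R"
    then show "P \<subseteq> Q \<or> Q \<subseteq> P"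
      \<comment> \<open>Since \<open>g\<close> reverses inclusion, the common upper bound
        \<open>R\<close> becomes the common lower bound \<open>g R\<close>.\<close>
      using up_linearD[OF up, of "g R" "g P" "g Q"] by (simp add: g_prime_filter g_subset_iff disj_commute)
  qed (rule no_three_chain_prime_filters)
qed (rule up_linear_if_union_of_disjoint_chains)

section \<open>The Stone identities\<close>

text \<open>The filter generated by \<open>P\<close> and \<open>x\<close> is proper: otherwise some
  \<open>m\<close> in \<open>P\<close> would be disjoint from \<open>x\<close>, so
  \<open>m \<le> pcompl x\<close> and \<open>pcompl x\<close> would be in \<open>P\<close>.\<close>

lemma extend_by_pcompl_notin:
  fixes x :: "'a::pseudocomplemented_kleene_algebra"
  assumes P: "P \<in> prime_filters" and x: "pcompl x \<notin> P"
  obtains Q where "Q \<in> prime_filters" "P \<subseteq> Q" "x \<in> Q"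
proof -
  have F: "lattice_filter P" using P unfolding prime_filters_def by blast
  have "bot \<notin> adjoin P x"
  proof
    assume "bot \<in> adjoin P x"
    then obtain m where "m \<in> P" "inf x m = bot"
      unfolding adjoin_def by (auto simp: bot_unique inf_commute)
    then show False using x prime_filter_up[OF P] by (simp add: pcompl_iff)
  qed
  then obtain Q where "Q \<in> prime_filters" "adjoin P x \<subseteq> Q"
    using prime_filter_separation[OF adjoin_filter[OF F]] by blast
  then show thesis using that subset_adjoin in_adjoin[OF F] by blast
qed

lemma stone_iff_up_linear:
  "(\<forall>x::'a::regular_pseudocomplemented_kleene_algebra. sup (pcompl x) (pcompl (pcompl x)) = top) \<longleftrightarrow>
   up_linear (prime_filters :: 'a set set)"
proof
  assume stone: "\<forall>x::'a. sup (pcompl x) (pcompl (pcompl x)) = top"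
  show "up_linear (prime_filters :: 'a set set)"
    unfolding up_linear_def
  proof (intro ballI impI, rule ccontr)
    fix P Q R :: "'a set"
    assume P: "P \<in> prime_filters" and Q: "Q \<in> prime_filters" and R: "R \<in> prime_filters"
      and PQ: "P \<subseteq> Q" and PR: "P \<subseteq> R" and incomp: "\<not> (Q \<subseteq> R \<or> R \<subseteq> Q)"
    obtain a where a: "a \<in> Q" "a \<notin> R" using incomp by blast
    have "P \<subset> R" using PQ PR incomp by blast
    then have "pcompl a \<in> R" using dense_in_nonminimal_prime_filter[OF P R] a by blast
    \<comment> \<open>The Stone identity inside \<open>P\<close> now yields
      \<open>pcompl (pcompl a)\<close>, which \<open>R\<close> inherits although it already contains
      \<open>pcompl a\<close>.\<close>
    moreover have "pcompl a \<notin> P" using pcompl_notin_prime_filter[OF Q] a PQ by blast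
    then have "pcompl (pcompl a) \<in> R"
      using stone prime_filter_sup[OF P] prime_filter_top[OF P] PR by (metis subsetD)
    ultimately show False using pcompl_notin_prime_filter[OF R] by blast
  qed
next
  assume up: "up_linear (prime_filters :: 'a set set)"
  show "\<forall>x::'a. sup (pcompl x) (pcompl (pcompl x)) = top"
  proof (rule allI, rule ccontr)
    fix x :: 'a
    assume "sup (pcompl x) (pcompl (pcompl x)) \<noteq> top"
    moreover have "lattice_filter {top::'a}"
      by (simp add: lattice_filter_def top_unique)
    ultimately obtain P where P: "P \<in> prime_filters" "sup (pcompl x) (pcompl (pcompl x)) \<notin> P"
      using prime_filter_separation by blast
    then have "pcompl x \<notin> P" "pcompl (pcompl x) \<notin> P"
      using prime_filter_up[OF P(1)] by (meson sup_ge1 sup_ge2)+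
    \<comment> \<open>The two missing pseudocomplements allow extensions of \<open>P\<close> by
      \<open>x\<close> and by \<open>pcompl x\<close>. If these were comparable, the larger would
      contain both elements.\<close>
    then obtain Q R where QR: "Q \<in> prime_filters" "P \<subseteq> Q" "x \<in> Q"
      "R \<in> prime_filters" "P \<subseteq> R" "pcompl x \<in> R"
      using extend_by_pcompl_notin[OF P(1)] by metis
    then have "Q \<subseteq> R \<or> R \<subseteq> Q" using up_linearD[OF up P(1)] by blast
    then show False using QR pcompl_notin_prime_filter by blast
  qed
qed

lemma upset_stone_iff_up_linear:
  "satisfies_stone
     (upset_algebra :: 'a::regular_pseudocomplemented_kleene_algebra set set pk_structure) \<longleftrightarrow>
   up_linear (prime_filters :: 'a set set)"
proof
  assume "satisfies_stone (upset_algebra :: 'a set set pk_structure)"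
  then have stone: "upset_star A \<union> upset_star (upset_star A) = prime_filters"
    if "A \<in> upsets" for A :: "'a set set"
    using that by (simp add: satisfies_stone_def upset_algebra_def)
  show "up_linear (prime_filters :: 'a set set)"
    unfolding up_linear_def
  proof (intro ballI impI, rule ccontr)
    fix P Q R :: "'a set"
    assume P: "P \<in> prime_filters" and Q: "Q \<in> prime_filters" and R: "R \<in> prime_filters"
      and PQ: "P \<subseteq> Q" and PR: "P \<subseteq> R" and incomp: "\<not> (Q \<subseteq> R \<or> R \<subseteq> Q)"
    \<comment> \<open>The identity is tested on the principal up-set of \<open>Q\<close>: it forces
      every prime filter above \<open>P\<close>, in particular \<open>R\<close>, to have a common
      upper bound \<open>S\<close> with \<open>Q\<close>.\<close>
    have "up Q \<in> upsets" by (auto simp: up_def upsets_def)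
    moreover have "P \<notin> upset_star (up Q)"
      using PQ Q by (auto simp: upset_star_def up_def)
    ultimately have "P \<in> upset_star (upset_star (up Q))" using stone P by blast
    then have "R \<notin> upset_star (up Q)" using R PR by (auto simp: upset_star_def up_def)
    then obtain S where S: "S \<in> prime_filters" "R \<subseteq> S" "Q \<subseteq> S"
      using R by (auto simp: upset_star_def up_def)
    \<comment> \<open>Equality \<open>R = S\<close> would give \<open>Q \<subseteq> R\<close>, and
      \<open>P = R\<close> would give \<open>R \<subseteq> Q\<close>.\<close>
    have "P \<subset> R" "R \<subset> S" using PQ PR S incomp by blast+
    then show False using no_three_chain_prime_filters P R S by blast
  qed
next
  assume up: "up_linear (prime_filters :: 'a set set)"
  have "P \<in> upset_star (upset_star A)"
    if A: "A \<in> upsets" and P: "P \<in> prime_filters" "P \<notin> upset_star A" for A and P :: "'a set"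
  proof -
    obtain Q where Q: "Q \<in> A" "Q \<in> prime_filters" "P \<subseteq> Q"
      using P by (auto simp: upset_star_def up_def)
    have "R \<notin> upset_star A" if R: "R \<in> prime_filters" "P \<subseteq> R" for R
    proof -
      \<comment> \<open>In the first case \<open>Q\<close> witnesses that \<open>up R\<close> meets
        \<open>A\<close>; otherwise \<open>Q \<subseteq> R\<close>, and the up-set \<open>A\<close>
        contains \<open>R\<close> itself.\<close>
      have "R \<subseteq> Q \<or> R \<in> A"
        using up_linearD[OF up P(1) Q(2) R(1) Q(3) R(2)] A Q R unfolding upsets_def by blast
      then show ?thesis using Q R by (auto simp: upset_star_def up_def)
    qed
    then show ?thesis using P by (auto simp: upset_star_def up_def)
  qed
  then have "upset_star A \<union> upset_star (upset_star A) = prime_filters"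
    if "A \<in> upsets" for A :: "'a set set"
    using that by (auto simp: upset_star_def)
  then show "satisfies_stone (upset_algebra :: 'a set set pk_structure)"
    by (simp add: satisfies_stone_def upset_algebra_def)
qed

theorem theorem5p3:
  shows "((\<forall>x::'a::regular_pseudocomplemented_kleene_algebra. sup (pcompl x) (pcompl (pcompl x)) = top) \<longleftrightarrow>
            union_of_disjoint_chains_le_2 (prime_filters :: 'a set set)) \<and>
         (union_of_disjoint_chains_le_2 (prime_filters :: 'a set set) \<longleftrightarrow>
            satisfies_stone (upset_algebra :: 'a set set pk_structure))"
  unfolding stone_iff_up_linear union_of_disjoint_chains_iff_up_linear upset_stone_iff_up_linear
  by simp

end
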